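(* Neither of the operations $+_R$ and $\cdot_R$ (addition and multiplication of decimals, regarded as operations $X_R\times X_R\to X_R$ on the canonical encoding $X_R$ of decimals) is computable.
   Context: $\mathbb{N}=\{1,2,\dots\}$, $\mathbb{N}_0=\{0,1,2,\dots\}$, $D=\{0,1,\dots,9\}$. **Decimals.** A decimal is a formal infinite linear combination $d=(-)\sum_{n\le k}d_n10^n$ with an optional minus sign, $k\in\mathbb{N}_0$ (the order of $d$), $n\in\mathbb{Z}$, $d_n\in D$, such that (i) $d_k=0$ implies $k=0$; (ii) there is no $n\le k$ with $d_m=9$ for all $m\le n$; (iii) $-\sum_{n\le 0}0\cdot10^n$ is not allowed. Digits $d_n$ with $n>k$ are set to $0$. Two decimals are equal iff they have equal signs, orders and digits. $\mathbb{R}$ denotes the set of decimals. **Arithmetic of decimals.** Let $\mathbb{Q}_D\subset\mathbb{Q}$ be the subring of fractions with a finite decimal expansion. For a decimal $d=(-)\sum_{n\le k}d_n10^n\in\mathbb{R}$ of order $k$ and $m\in\mathbb{N}$ let $r(d\,|\,m)=\pm\sum_{-m\le n\le k}d_n10^n\in\mathbb{Q}_D$ (with the sign of $d$) be the value of the $m$-th truncation of $d$. A sequence $(a_n)\subset\mathbb{Q}_D$ is Cauchy if for every $k\in\mathbb{N}$ there is $n_0\in\mathbb{N}$ with $|a_m-a_n|<1/k$ for all $m,n\ge n_0$. A Cauchy sequence $(a_n)\subset\mathbb{Q}_D$ generates $d$, written $d=G(a_n)$, if for every $k\in\mathbb{N}$ there is $n_0\in\mathbb{N}$ such that $|r(d\,|\,n)-a_n|<1/k$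 for all $n\ge n_0$. Every decimal has a generating sequence and every Cauchy sequence in $\mathbb{Q}_D$ generates exactly one decimal. For $d=G(a_n)$, $e=G(b_n)$ one defines $d+_Re:=G(a_n+b_n)$ and $d\cdot_Re:=G(a_nb_n)$ (independent of the choice of generating sequences). **Encodings and operations.** For a nonempty finite alphabet $A$ let $A^{\infty}=A^{\mathbb{N}_0}$ be the set of one-way infinite words over $A$. An encoding is a nonempty subset $X\subset A^\infty$. An operation on $X$ is a map $F\colon X\times X\to X$. **Canonical encoding $X_R$.** Let $A=D\cup\{-,\xi\}$, with $\xi$ a separation symbol. A decimal $d=(-)\sum_{n\le k}d_n10^n$ of order $k$ is encoded as the word $u(d)\in A^\infty$ consisting of the minus sign if $d$ has one, then the binary digits of $k$ (least significant digit first; $0$ is written as the single digit $0$), then $\xi$, then the digits $d_k,d_{k-1},d_{k-2},\dots$ in this order. $X_R=\{u(d)\mid d\in\mathbb{R}\}$, and $+_R,\cdot_R$ are transported to $X_R$ via the bijection $d\mapsto u(d)$. **Machines and computability.** A machine $M$ (for an encoding $X\subset A^\infty$) is a Turing machine with a finite set of states containing an initial state and a terminal state, and with a finite alphabet $A'\supset A\cup\{0,1,\epsilon\}$, where $\epsilon\in A'\setminus A$ is the empty cell symbol. It operates on three bi-infinite tapes $T_1,T_2,T_3$, with cells labeled by $\mathbb{Z}$, via corresponding heads $H_1,H_2,H_3$; $H_1,H_2$ only read, $H_3$ reads and writes. An input is a triple $(x,y,m)\in X\times X\times\mathbb{N}_0$: the word $x=x_0x_1\dots$ is stored on $T_1$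 with $x_n$ in cell $n$ and $\epsilon$ in every cell $n<0$; $y$ is stored on $T_2$ in the same way; $m$ is stored in binary on $T_3$ with the least significant digit in cell $0$ and successive digits in cells $1,2,\dots$, all other cells containing $\epsilon$. The computation starts in the initial state with every head at cell $0$. In each step, if $M$ is in the terminal state the computation terminates; otherwise, depending only on the current state and the contents of the three currently scanned cells, $M$ rewrites the scanned cell of $T_3$, moves each head by $-1$, $0$ or $+1$, and passes to a new (possibly the same) state, according to its finite instruction table. An operation $F\colon X\times X\to X$ is computed by $M$ if for every input $(x,y,m)\in X^2\times\mathbb{N}_0$ the computation of $M$ terminates with $z_m$ in cell $0$ of $T_3$ and $\epsilon$ in all other cells of $T_3$, where $F(x,y)=z_0z_1z_2\dots$. $F$ is computable if some machine computes it. *)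

theory Defs
  imports Complex_Main "HOL-Library.Omega_Words_Fun"
begin

text \<open>The digit function is total on the integers; digits above the order are 0, so that equality
  of decimals is equality of signs, orders and digits.\<close>

datatype decimal = Decimal (is_neg: bool) (ord_of: nat) (digit: "int \<Rightarrow> nat")

definition decimals :: "decimal set" where
  "decimals = {d.
     (\<forall>n. digit d n \<le> 9) \<and>
     (\<forall>n > int (ord_of d). digit d n = 0) \<and>
     (digit d (int (ord_of d)) = 0 \<longrightarrow> ord_of d = 0) \<and>
     \<not> (\<exists>n \<le> int (ord_of d). \<forall>m \<le> n. digit d m = 9) \<and>
     \<not> (is_neg d \<and> ord_of d = 0 \<and> (\<forall>n \<le> 0. digit d n = 0))}"

definition Q_D :: "rat set" where
  "Q_D = {q. \<exists>(a::int) (n::nat). q = of_int a / 10 ^ n}"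

definition trunc :: "decimal \<Rightarrow> nat \<Rightarrow> rat" where
  "trunc d m = (if is_neg d then - 1 else 1) *
     (\<Sum>n = - int m..int (ord_of d). of_nat (digit d n) * 10 powi n)"

text \<open>Sequences are indexed by the positive integers; the value at 0 is irrelevant.\<close>

definition cauchy_QD :: "(nat \<Rightarrow> rat) \<Rightarrow> bool" where
  "cauchy_QD a \<longleftrightarrow> (\<forall>n\<ge>1. a n \<in> Q_D) \<and>
     (\<forall>k\<ge>1. \<exists>n0\<ge>1. \<forall>m\<ge>n0. \<forall>n\<ge>n0. \<bar>a m - a n\<bar> < 1 / of_nat k)"

definition generates :: "(nat \<Rightarrow> rat) \<Rightarrow> decimal \<Rightarrow> bool" where
  "generates a d \<longleftrightarrow> cauchy_QD a \<and> d \<in> decimals \<and>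
     (\<forall>k\<ge>1. \<exists>n0\<ge>1. \<forall>n\<ge>n0. \<bar>trunc d n - a n\<bar> < 1 / of_nat k)"

text \<open>Every decimal has a generating sequence, and the decimal generated by the sum or product
  sequence exists, is unique and does not depend on the chosen generating sequences; hence the
  descriptions below denote for arguments in \<open>decimals\<close>.\<close>

definition dec_add :: "decimal \<Rightarrow> decimal \<Rightarrow> decimal" where
  "dec_add d e =
     (THE f. \<exists>a b. generates a d \<and> generates b e \<and> generates (\<lambda>n. a n + b n) f)"

definition dec_mult :: "decimal \<Rightarrow> decimal \<Rightarrow> decimal" where
  "dec_mult d e =
     (THE f. \<exists>a b. generates a d \<and> generates b e \<and> generates (\<lambda>n. a n * b n) f)"

text \<open>A universe of tape symbols. Concrete alphabets are finite sets of symbols; \<open>Aux\<close> provides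
  arbitrarily many further symbols for the work alphabets of machines.\<close>

datatype symbol = Digit nat | Minus | Sep | Blank | Aux nat

definition A_R :: "symbol set" where
  "A_R = Digit ` {0..9} \<union> {Minus, Sep}"

text \<open>Least significant digit first; 0 is written as the single digit 0.\<close>

fun binary :: "nat \<Rightarrow> nat list" where
  "binary n = (if n < 2 then [n] else n mod 2 # binary (n div 2))"

declare binary.simps [simp del]

definition encode :: "decimal \<Rightarrow> symbol word" where
  "encode d =
     ((if is_neg d then [Minus] else []) @ map Digit (binary (ord_of d)) @ [Sep])
       \<frown> (\<lambda>i. Digit (digit d (int (ord_of d) - int i)))"

definition X_R :: "symbol word set" where
  "X_R = encode ` decimals"

definition transport ::
  "(decimal \<Rightarrow> decimal \<Rightarrow> decimal) \<Rightarrow> symbol word \<Rightarrow> symbol word \<Rightarrow> symbol word" where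
  "transport f x y = encode (f (the_inv_into decimals encode x) (the_inv_into decimals encode y))"

definition add_R :: "symbol word \<Rightarrow> symbol word \<Rightarrow> symbol word" where
  "add_R = transport dec_add"

definition mult_R :: "symbol word \<Rightarrow> symbol word \<Rightarrow> symbol word" where
  "mult_R = transport dec_mult"

text \<open>States are natural numbers, which is no restriction for finite state sets. The instruction
  table takes the state and the symbols scanned on the three tapes to the new state, the symbol
  written on the third tape and the moves of the three heads.\<close>

record machine =
  states :: "nat set"
  initial :: nat
  terminal :: nat
  alphabet :: "symbol set"
  instr :: "nat \<Rightarrow> symbol \<Rightarrow> symbol \<Rightarrow> symbol \<Rightarrow> nat \<times> symbol \<times> int \<times> int \<times> int"

definition is_machine :: "symbol set \<Rightarrow> machine \<Rightarrow> bool" where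
  "is_machine A M \<longleftrightarrow>
     finite (states M) \<and> initial M \<in> states M \<and> terminal M \<in> states M \<and>
     finite (alphabet M) \<and> A \<union> {Digit 0, Digit 1, Blank} \<subseteq> alphabet M \<and> Blank \<notin> A \<and>
     (\<forall>q \<in> states M - {terminal M}. \<forall>a \<in> alphabet M. \<forall>b \<in> alphabet M. \<forall>c \<in> alphabet M.
        instr M q a b c \<in> states M \<times> alphabet M \<times> {-1, 0, 1} \<times> {-1, 0, 1} \<times> {-1, 0, 1})"

text \<open>The first two tapes are never changed, so they are not part of the configuration.\<close>

record config =
  state :: nat
  head1 :: int
  head2 :: int
  head3 :: int
  tape3 :: "int \<Rightarrow> symbol"

definition word_tape :: "symbol word \<Rightarrow> int \<Rightarrow> symbol" where
  "word_tape x i = (if i < 0 then Blank else x (nat i))"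

definition list_tape :: "symbol list \<Rightarrow> int \<Rightarrow> symbol" where
  "list_tape xs i = (if 0 \<le> i \<and> i < int (length xs) then xs ! nat i else Blank)"

definition start :: "machine \<Rightarrow> nat \<Rightarrow> config" where
  "start M m = \<lparr>state = initial M, head1 = 0, head2 = 0, head3 = 0,
     tape3 = list_tape (map Digit (binary m))\<rparr>"

definition step :: "machine \<Rightarrow> symbol word \<Rightarrow> symbol word \<Rightarrow> config \<Rightarrow> config" where
  "step M x y c =
     (if state c = terminal M then c
      else case instr M (state c) (word_tape x (head1 c)) (word_tape y (head2 c))
                  (tape3 c (head3 c)) of
        (q, s, i, j, k) \<Rightarrow>
          \<lparr>state = q, head1 = head1 c + i, head2 = head2 c + j, head3 = head3 c + k,
           tape3 = (tape3 c)(head3 c := s)\<rparr>)"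

definition computes ::
  "machine \<Rightarrow> symbol word set \<Rightarrow> (symbol word \<Rightarrow> symbol word \<Rightarrow> symbol word) \<Rightarrow> bool" where
  "computes M X F \<longleftrightarrow>
     (\<forall>x\<in>X. \<forall>y\<in>X. \<forall>m. \<exists>t.
        let c = (step M x y ^^ t) (start M m)
        in state c = terminal M \<and> tape3 c = list_tape [F x y m])"

text \<open>Here \<open>X\<close> is an encoding over the alphabet \<open>A\<close> and \<open>F\<close> maps \<open>X \<times> X\<close> to \<open>X\<close>; the values of
  \<open>F\<close> elsewhere play no role.\<close>

definition computable ::
  "symbol set \<Rightarrow> symbol word set \<Rightarrow> (symbol word \<Rightarrow> symbol word \<Rightarrow> symbol word) \<Rightarrow> bool" where
  "computable A X F \<longleftrightarrow> (\<exists>M. is_machine A M \<and> computes M X F)"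

end

theory Submission
  imports Defs
begin

text \<open>
  A machine that halts has looked at only finitely many cells of its input tapes. Hence every output
  symbol of a computable operation is locally constant: it does not change when the two input words
  are altered far enough to the right (\<open>computable_imp_locally_constant\<close>).

  Addition and multiplication of decimals violate this at the very first output symbol, which shows
  whether the result is negative. Since \<open>- 0\<close> is not a decimal, results that tend to 0 from below
  begin with the minus sign, whereas the word of 0 begins with the digit 0. In detail,
  \<open>- (1 + \<delta>) + 1 = - \<delta>\<close> and \<open>\<delta> \<sqdot> (- 1) = - \<delta>\<close> for \<open>\<delta> = 10\<^bsup>- (N + 1)\<^esup>\<close>. The first arguments
  \<open>- (1 + \<delta>)\<close> and \<open>\<delta>\<close> share the first \<open>N\<close> symbols of their words with \<open>- 1\<close> and \<open>0\<close>, for which the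
  results are 0. Thus no finite part of the inputs determines the first output symbol.

  To evaluate these sums and products one needs that the defining descriptions of the operations
  denote. The point is that a decimal is determined by the limit of its truncations
  (\<open>decimal_eqI_limit\<close>), which holds because tails of nines and the negative zero are excluded. To
  pass from words back to decimals one needs that the encoding is injective
  (\<open>inj_on_encode\<close>).
\<close>

section \<open>Computable operations are locally constant in each output symbol\<close>

text \<open>By induction on the number of steps, because each step scans at most one further cell of
  each input tape. The heads visit finitely many cells during a given finite number of steps whatever
  the instruction table says.\<close>

lemma computation_depends_on_prefixes:
  "\<exists>N. \<forall>x' y'. (\<forall>i<N. x' i = x i) \<longrightarrow> (\<forall>i<N. y' i = y i) \<longrightarrow>
     (step M x' y' ^^ t) c = (step M x y ^^ t) c"
proof (induction t)
  case 0
  show ?case by simp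
next
  case (Suc t)
  then obtain N where N: "\<And>x' y'. (\<forall>i<N. x' i = x i) \<Longrightarrow> (\<forall>i<N. y' i = y i) \<Longrightarrow>
     (step M x' y' ^^ t) c = (step M x y ^^ t) c"
    by blast
  define c' where "c' = (step M x y ^^ t) c"
  let ?N = "Max {N, Suc (nat (head1 c')), Suc (nat (head2 c'))}"
  show ?case
  proof (intro exI[of _ ?N] allI impI)
    fix x' y' :: "symbol word"
    assume x': "\<forall>i<?N. x' i = x i" and y': "\<forall>i<?N. y' i = y i"
    have "(step M x' y' ^^ t) c = c'"
      unfolding c'_def using x' y' by (intro N) auto
    moreover have "word_tape x' (head1 c') = word_tape x (head1 c')"
      using x' by (auto simp: word_tape_def)
    moreover have "word_tape y' (head2 c') = word_tape y (head2 c')"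
      using y' by (auto simp: word_tape_def)
    ultimately show "(step M x' y' ^^ Suc t) c = (step M x y ^^ Suc t) c"
      by (simp add: step_def flip: c'_def)
  qed
qed

lemma terminal_config_stable:
  assumes "state ((step M x y ^^ t) c) = terminal M" and "t \<le> t'"
  shows "(step M x y ^^ t') c = (step M x y ^^ t) c"
  using assms(2,1) by (induction rule: dec_induct) (simp_all add: step_def)

lemma terminal_config_unique:
  assumes "state ((step M x y ^^ t) c) = terminal M" "state ((step M x y ^^ t') c) = terminal M"
  shows "(step M x y ^^ t) c = (step M x y ^^ t') c"
  using terminal_config_stable[OF assms(1), of t'] terminal_config_stable[OF assms(2), of t]
  by (metis nle_le)

lemma computable_imp_locally_constant:
  assumes "computable A X F" "x \<in> X" "y \<in> X"
  obtains N where "\<And>x' y'. x' \<in> X \<Longrightarrow> y' \<in> X \<Longrightarrow> (\<And>i. i < N \<Longrightarrow> x' i = x i) \<Longrightarrow>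
    (\<And>i. i < N \<Longrightarrow> y' i = y i) \<Longrightarrow> F x' y' m = F x y m"
proof -
  obtain M where M: "computes M X F"
    using assms(1) by (auto simp: computable_def)
  obtain t where t: "state ((step M x y ^^ t) (start M m)) = terminal M"
      "tape3 ((step M x y ^^ t) (start M m)) = list_tape [F x y m]"
    using M assms(2,3) unfolding computes_def Let_def by blast
  obtain N where N: "\<And>x' y'. (\<forall>i<N. x' i = x i) \<Longrightarrow> (\<forall>i<N. y' i = y i) \<Longrightarrow>
     (step M x' y' ^^ t) (start M m) = (step M x y ^^ t) (start M m)"
    using computation_depends_on_prefixes[of x y t M "start M m"] by blast
  show thesis
  proof (rule that[of N])
    fix x' y'
    assume X: "x' \<in> X" "y' \<in> X" and eq: "\<And>i. i < N \<Longrightarrow> x' i = x i" "\<And>i. i < N \<Longrightarrow> y' i = y i"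
    obtain t' where t': "state ((step M x' y' ^^ t') (start M m)) = terminal M"
        "tape3 ((step M x' y' ^^ t') (start M m)) = list_tape [F x' y' m]"
      using M X unfolding computes_def Let_def by blast
    have "(step M x' y' ^^ t) (start M m) = (step M x y ^^ t) (start M m)"
      using N eq by blast
    then have "(step M x y ^^ t) (start M m) = (step M x' y' ^^ t') (start M m)"
      using terminal_config_unique t(1) t'(1) by metis
    then have "list_tape [F x' y' m] 0 = list_tape [F x y m] 0"
      using t(2) t'(2) by simp
    then show "F x' y' m = F x y m"
      by (simp add: list_tape_def)
  qed
qed

section \<open>A decimal is determined by the limit of its truncations\<close>

lemma decimals_digit_le: "d \<in> decimals \<Longrightarrow> digit d n \<le> 9"
  and decimals_digit_above: "d \<in> decimals \<Longrightarrow> n > int (ord_of d) \<Longrightarrow> digit d n = 0"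
  and decimals_leading: "d \<in> decimals \<Longrightarrow> digit d (int (ord_of d)) = 0 \<Longrightarrow> ord_of d = 0"
  by (auto simp: decimals_def)

lemma decimals_no_nine_tail:
  assumes "d \<in> decimals"
  obtains l where "l < j" "digit d l \<noteq> 9"
proof -
  have "min (j - 1) (int (ord_of d)) \<le> int (ord_of d)" by simp
  then obtain l where "l \<le> min (j - 1) (int (ord_of d))" "digit d l \<noteq> 9"
    using assms unfolding decimals_def by blast
  then show thesis using that[of l] by auto
qed

lemma decimals_neg_nonzero:
  assumes "d \<in> decimals" "is_neg d"
  obtains i where "i \<le> int (ord_of d)" "digit d i \<noteq> 0"
  using assms unfolding decimals_def by force

lemma ord_of_determined_by_digits:
  assumes "d \<in> decimals" "e \<in> decimals" "digit d = digit e"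
  shows "ord_of d = ord_of e"
  using assms decimals_digit_above decimals_leading
  by (metis linorder_neqE_nat not_less_zero of_nat_less_iff)

definition magnitude :: "decimal \<Rightarrow> nat \<Rightarrow> rat" where
  "magnitude d m = (\<Sum>n = - int m..int (ord_of d). of_nat (digit d n) * 10 powi n)"

lemma trunc_magnitude: "trunc d m = (if is_neg d then - magnitude d m else magnitude d m)"
  by (simp add: trunc_def magnitude_def)

lemma magnitude_nonneg: "0 \<le> magnitude d m"
  unfolding magnitude_def by (intro sum_nonneg) auto

text \<open>The order may be replaced by any larger bound, so that two decimals of different orders can be
  compared digit by digit.\<close>

lemma magnitude_extend:
  assumes "d \<in> decimals" "int (ord_of d) \<le> K"
  shows "magnitude d m = (\<Sum>n = - int m..K. of_nat (digit d n) * 10 powi n)"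
  unfolding magnitude_def using assms decimals_digit_above[OF assms(1)]
  by (intro sum.mono_neutral_left) auto

text \<open>At the highest differing place \<open>j\<close> the larger expansion leads by \<open>10\<^bsup>j\<^esup>\<close> at least. The lower
  digits of the other one can make up for this only if all of them are 9: down to the place \<open>m\<close> a
  lead of \<open>10\<^bsup>m\<^esup>\<close> always remains, and a digit other than 9 at place \<open>l\<close> doubles this bound there,
  after which \<open>10\<^bsup>l\<^esup>\<close> is never lost again.\<close>

lemma digit_sums_gap:
  fixes p q :: "int \<Rightarrow> nat"
  assumes above: "\<And>i. i > j \<Longrightarrow> p i = q i" and "q j < p j" and nines: "\<And>i. q i \<le> 9"
    and "l < j" "q l \<noteq> 9" "j \<le> K" "m \<le> l"
  shows "(10::rat) powi l \<le>
    (\<Sum>i=m..K. of_nat (p i) * 10 powi i) - (\<Sum>i=m..K. of_nat (q i) * 10 powi i)"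
proof -
  define D :: "int \<Rightarrow> rat" where
    "D m = (\<Sum>i=m..K. (of_nat (p i) - of_nat (q i)) * 10 powi i)" for m
  have D_step: "D (i - 1) = (of_nat (p (i - 1)) - of_nat (q (i - 1))) * 10 powi (i - 1) + D i"
    if "i \<le> j" for i
  proof -
    have "{i - 1..K} = insert (i - 1) {i..K}"
      using that \<open>j \<le> K\<close> by auto
    then show ?thesis by (simp add: D_def)
  qed
  have power_step: "(10::rat) powi i = 10 * 10 powi (i - 1)" for i
    using power_int_add_1'[of "10::rat" "i - 1"] by simp
  have digit_loss: "- (of_nat k * (10::rat) powi i) \<le> (of_nat (p i) - of_nat (q i)) * 10 powi i"
    if "q i \<le> k" for i k
  proof -
    have "- of_nat k \<le> (of_nat (p i) - of_nat (q i) :: rat)"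
      using that by (simp add: algebra_simps flip: of_nat_add)
    then have "- of_nat k * (10::rat) powi i \<le> (of_nat (p i) - of_nat (q i)) * 10 powi i"
      by (rule mult_right_mono) simp
    then show ?thesis by simp
  qed
  have lead: "10 powi i \<le> D i" if "i \<le> j" for i
    using that
  proof (induction rule: int_le_induct)
    case base
    have "{j..K} = insert j {j<..K}"
      using \<open>j \<le> K\<close> by auto
    then have "D j = (of_nat (p j) - of_nat (q j)) * 10 powi j"
      using above by (simp add: D_def)
    moreover have "1 \<le> (of_nat (p j) - of_nat (q j) :: rat)"
      using \<open>q j < p j\<close> by (simp add: le_diff_eq flip: of_nat_Suc)
    then have "1 * 10 powi j \<le> (of_nat (p j) - of_nat (q j)) * (10::rat) powi j"
      by (rule mult_right_mono) simp
    ultimately show ?case by simp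
  next
    case (step i)
    then show ?case
      using D_step[of i] power_step[of i] digit_loss[OF nines, of "i - 1"] by simp
  qed
  have lasting: "10 powi l + 10 powi i \<le> D i" if "i \<le> l" for i
    using that
  proof (induction rule: int_le_induct)
    case base
    have "q l \<le> 8"
      using nines[of l] \<open>q l \<noteq> 9\<close> by simp
    then show ?case
      using lead[of "l + 1"] D_step[of "l + 1"] power_step[of "l + 1"] digit_loss[of l 8] \<open>l < j\<close>
      by simp
  next
    case (step i)
    then show ?case
      using D_step[of i] power_step[of i] digit_loss[OF nines, of "i - 1"] \<open>l < j\<close> by simp
  qed
  have "D m = (\<Sum>i=m..K. of_nat (p i) * 10 powi i) - (\<Sum>i=m..K. of_nat (q i) * 10 powi i)"
    by (simp add: D_def left_diff_distrib sum_subtractf)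
  moreover have "(0::rat) \<le> 10 powi m"
    by simp
  ultimately show ?thesis
    using lasting[OF \<open>m \<le> l\<close>] by linarith
qed

lemma magnitudes_separated:
  assumes "d \<in> decimals" "e \<in> decimals" "digit d \<noteq> digit e"
  shows "\<exists>c>0. \<forall>\<^sub>F n in sequentially. c \<le> \<bar>magnitude d n - magnitude e n\<bar>"
proof -
  define K where "K = int (max (ord_of d) (ord_of e))"
  obtain i where i: "digit d i \<noteq> digit e i"
    using assms(3) by auto
  have "i \<le> K"
    using i decimals_digit_above[OF assms(1), of i] decimals_digit_above[OF assms(2), of i]
    by (force simp: K_def)
  \<comment> \<open>The highest differing place, found as the least distance from the common bound \<open>K\<close>.\<close>
  define k where "k = (LEAST k. digit d (K - int k) \<noteq> digit e (K - int k))"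
  define j where "j = K - int k"
  have "digit d (K - int (nat (K - i))) \<noteq> digit e (K - int (nat (K - i)))"
    using i \<open>i \<le> K\<close> by simp
  then have j: "digit d j \<noteq> digit e j"
    unfolding j_def k_def by (rule LeastI)
  have above: "digit d i = digit e i" if "j < i" for i
  proof (cases "i \<le> K")
    case True
    then have "nat (K - i) < k"
      using that by (simp add: j_def)
    then have "digit d (K - int (nat (K - i))) = digit e (K - int (nat (K - i)))"
      using not_less_Least k_def by blast
    then show ?thesis using True by simp
  next
    case False
    then show ?thesis
      using decimals_digit_above[OF assms(1), of i] decimals_digit_above[OF assms(2), of i]
      by (simp add: K_def)
  qed
  have gap: "\<exists>c>0. \<forall>\<^sub>F n in sequentially. c \<le> magnitude d n - magnitude e n"
    if d: "d \<in> decimals" "int (ord_of d) \<le> K" and e: "e \<in> decimals" "int (ord_of e) \<le> K"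
      and above: "\<And>i. i > j \<Longrightarrow> digit d i = digit e i" and less: "digit e j < digit d j" for d e
  proof -
    obtain l where l: "l < j" "digit e l \<noteq> 9"
      using decimals_no_nine_tail[OF e(1)] by blast
    have "10 powi l \<le> magnitude d n - magnitude e n" if "nat (- l) \<le> n" for n
      unfolding magnitude_extend[OF d] magnitude_extend[OF e]
      using l that above less decimals_digit_le[OF e(1)]
      by (intro digit_sums_gap[where j = j]) (auto simp: j_def)
    then show ?thesis
      by (intro exI[of _ "10 powi l"]) (auto simp: eventually_sequentially)
  qed
  have K: "int (ord_of d) \<le> K" "int (ord_of e) \<le> K"
    by (auto simp: K_def)
  consider "digit e j < digit d j" | "digit d j < digit e j"
    using j by linarith
  then obtain c where "c > 0" "\<forall>\<^sub>F n in sequentially.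
      c \<le> magnitude d n - magnitude e n \<or> c \<le> magnitude e n - magnitude d n"
  proof cases
    case 1
    then show thesis
      using gap[OF assms(1) K(1) assms(2) K(2) above] that by (blast intro: eventually_mono)
  next
    case 2
    then show thesis
      using gap[OF assms(2) K(2) assms(1) K(1)] above that
      by (metis (mono_tags, lifting) eventually_mono)
  qed
  then show ?thesis
    by (intro exI[of _ c]) (auto elim!: eventually_mono)
qed

text \<open>For equal signs this is the gap between the magnitudes. For different signs the magnitudes add
  up, and the negative one stays away from 0 because it has a digit other than 0.\<close>

lemma truncations_separated:
  assumes d: "d \<in> decimals" and e: "e \<in> decimals" and "d \<noteq> e"
  shows "\<exists>c>0. \<forall>\<^sub>F n in sequentially. c \<le> \<bar>trunc d n - trunc e n\<bar>"
proof (cases "is_neg d = is_neg e")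
  case True
  then have "digit d \<noteq> digit e"
    using \<open>d \<noteq> e\<close> ord_of_determined_by_digits[OF d e] by (auto intro: decimal.expand)
  then obtain c where "c > 0" "\<forall>\<^sub>F n in sequentially. c \<le> \<bar>magnitude d n - magnitude e n\<bar>"
    using magnitudes_separated[OF d e] by blast
  then show ?thesis
    using True by (intro exI[of _ c]) (auto simp: trunc_magnitude abs_minus_commute)
next
  case False
  have gap: "\<exists>c>0. \<forall>\<^sub>F n in sequentially. c \<le> magnitude e n"
    if e: "e \<in> decimals" "is_neg e" for e
  proof -
    obtain i where i: "i \<le> int (ord_of e)" "digit e i \<noteq> 0"
      using decimals_neg_nonzero[OF e] by blast
    have "10 powi i \<le> magnitude e n" if "nat (- i) \<le> n" for n
    proof -
      have "1 * (10::rat) powi i \<le> of_nat (digit e i) * 10 powi i"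
        using i(2) by (intro mult_right_mono) (auto simp: Suc_le_eq)
      also have "\<dots> \<le> magnitude e n"
        unfolding magnitude_def using i(1) that by (intro member_le_sum) auto
      finally show ?thesis by simp
    qed
    then show ?thesis
      by (intro exI[of _ "10 powi i"]) (auto simp: eventually_sequentially)
  qed
  obtain c where c: "c > 0" "\<forall>\<^sub>F n in sequentially. c \<le> magnitude d n + magnitude e n"
  proof (cases "is_neg e")
    case True
    then obtain c where "c > 0" "\<forall>\<^sub>F n in sequentially. c \<le> magnitude e n"
      using gap[OF e] by blast
    then show thesis
      using magnitude_nonneg[of d] by (intro that[of c])
        (auto elim!: eventually_mono intro: add_increasing)
  next
    case _: False
    then obtain c where "c > 0" "\<forall>\<^sub>F n in sequentially. c \<le> magnitude d n"
      using gap[OF d] \<open>is_neg d \<noteq> is_neg e\<close> by blast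
    then show thesis
      using magnitude_nonneg[of e] by (intro that[of c])
        (auto elim!: eventually_mono intro: add_increasing2)
  qed
  have "\<bar>trunc d n - trunc e n\<bar> = magnitude d n + magnitude e n" for n
    using False magnitude_nonneg[of d n] magnitude_nonneg[of e n] by (auto simp: trunc_magnitude)
  then show ?thesis
    using c by auto
qed

lemma of_rat_dist: "\<bar>real_of_rat p - real_of_rat q\<bar> = real_of_rat \<bar>p - q\<bar>"
  by (simp add: abs_if flip: of_rat_diff of_rat_minus)

lemma decimal_eqI_limit:
  assumes "d \<in> decimals" "e \<in> decimals"
    and lim: "(\<lambda>n. real_of_rat (trunc d n)) \<longlonglongrightarrow> L" "(\<lambda>n. real_of_rat (trunc e n)) \<longlonglongrightarrow> L"
  shows "d = e"
proof (rule ccontr)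
  assume "d \<noteq> e"
  then obtain c where "c > 0" and c: "\<forall>\<^sub>F n in sequentially. c \<le> \<bar>trunc d n - trunc e n\<bar>"
    using truncations_separated assms by blast
  have "(\<lambda>n. \<bar>real_of_rat (trunc d n) - real_of_rat (trunc e n)\<bar>) \<longlonglongrightarrow> 0"
    using tendsto_rabs[OF tendsto_diff[OF lim]] by simp
  then have "\<forall>\<^sub>F n in sequentially.
      \<bar>real_of_rat (trunc d n) - real_of_rat (trunc e n)\<bar> < real_of_rat c"
    using \<open>c > 0\<close> by (intro order_tendstoD(2)) auto
  then have "\<forall>\<^sub>F n in sequentially. False"
    using c
  proof eventually_elim
    case (elim n)
    then show ?case
      by (simp add: of_rat_dist of_rat_less)
  qed
  then show False by simp
qed

section \<open>Sums and products of decimals\<close>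

lemma LIMSEQ_zeroI_inverse_nat:
  fixes f :: "nat \<Rightarrow> real"
  assumes "\<And>k. k \<ge> 1 \<Longrightarrow> \<exists>n0. \<forall>n\<ge>n0. \<bar>f n\<bar> < 1 / of_nat k"
  shows "f \<longlonglongrightarrow> 0"
proof (rule LIMSEQ_I)
  fix r :: real
  assume "0 < r"
  then obtain k where k: "inverse (real (Suc k)) < r"
    using reals_Archimedean by blast
  show "\<exists>n0. \<forall>n\<ge>n0. norm (f n - 0) < r"
    using assms[of "Suc k"] k unfolding inverse_eq_divide
    by (metis diff_zero le_add1 less_trans plus_1_eq_Suc real_norm_def)
qed

text \<open>The passage to real numbers allows sums and products of generating sequences to be treated by
  the limit laws.\<close>

lemma generates_limit:
  assumes "generates a d"
  obtains L where "(\<lambda>n. real_of_rat (a n)) \<longlonglongrightarrow> L" "(\<lambda>n. real_of_rat (trunc d n)) \<longlonglongrightarrow> L"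
proof -
  have less: "\<bar>real_of_rat p - real_of_rat q\<bar> < 1 / real k \<longleftrightarrow> \<bar>p - q\<bar> < 1 / of_nat k" for p q k
    unfolding of_rat_dist of_rat_less[where 'a = real, symmetric] by (simp add: of_rat_divide)
  have "Cauchy (\<lambda>n. real_of_rat (a n))"
  proof (rule metric_CauchyI)
    fix r :: real
    assume "0 < r"
    then obtain k where k: "inverse (real (Suc k)) < r"
      using reals_Archimedean by blast
    have "cauchy_QD a" and "1 \<le> Suc k"
      using assms by (simp_all add: generates_def)
    then obtain n0 where "\<forall>m\<ge>n0. \<forall>n\<ge>n0. \<bar>a m - a n\<bar> < 1 / of_nat (Suc k)"
      unfolding cauchy_QD_def by blast
    then have "\<forall>m\<ge>n0. \<forall>n\<ge>n0. \<bar>real_of_rat (a m) - real_of_rat (a n)\<bar> < 1 / real (Suc k)"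
      by (simp only: less)
    then show "\<exists>n0. \<forall>m\<ge>n0. \<forall>n\<ge>n0. dist (real_of_rat (a m)) (real_of_rat (a n)) < r"
      using k unfolding dist_real_def inverse_eq_divide by (blast intro: less_trans)
  qed
  then obtain L where L: "(\<lambda>n. real_of_rat (a n)) \<longlonglongrightarrow> L"
    using Cauchy_convergent convergent_def by blast
  have "(\<lambda>n. real_of_rat (trunc d n) - real_of_rat (a n)) \<longlonglongrightarrow> 0"
  proof (rule LIMSEQ_zeroI_inverse_nat)
    fix k :: nat
    assume "k \<ge> 1"
    then show "\<exists>n0. \<forall>n\<ge>n0. \<bar>real_of_rat (trunc d n) - real_of_rat (a n)\<bar> < 1 / real k"
      using assms unfolding generates_def less by blast
  qed
  then have "(\<lambda>n. real_of_rat (trunc d n)) \<longlonglongrightarrow> L"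
    using tendsto_add[OF L] by fastforce
  with L show thesis by (rule that)
qed

lemma generates_limit_iff:
  assumes "generates a d"
  shows "(\<lambda>n. real_of_rat (a n)) \<longlonglongrightarrow> L \<longleftrightarrow> (\<lambda>n. real_of_rat (trunc d n)) \<longlonglongrightarrow> L"
  using generates_limit[OF assms] LIMSEQ_unique by metis

lemma generating_sequences_common_limit:
  assumes "generates a d" "generates b d"
  obtains L where "(\<lambda>n. real_of_rat (a n)) \<longlonglongrightarrow> L" "(\<lambda>n. real_of_rat (b n)) \<longlonglongrightarrow> L"
proof -
  obtain L where L: "(\<lambda>n. real_of_rat (a n)) \<longlonglongrightarrow> L"
    using generates_limit[OF assms(1)] by blast
  then have "(\<lambda>n. real_of_rat (b n)) \<longlonglongrightarrow> L"
    unfolding generates_limit_iff[OF assms(1)] generates_limit_iff[OF assms(2)] .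
  with L show thesis by (rule that)
qed

lemma generated_decimal_unique:
  assumes "generates a d" "generates b e"
    and "(\<lambda>n. real_of_rat (a n)) \<longlonglongrightarrow> L" "(\<lambda>n. real_of_rat (b n)) \<longlonglongrightarrow> L"
  shows "d = e"
proof (rule decimal_eqI_limit)
  show "d \<in> decimals" "e \<in> decimals"
    using assms(1,2) by (simp_all add: generates_def)
  show "(\<lambda>n. real_of_rat (trunc d n)) \<longlonglongrightarrow> L" "(\<lambda>n. real_of_rat (trunc e n)) \<longlonglongrightarrow> L"
    using assms(3,4) generates_limit_iff[OF assms(1)] generates_limit_iff[OF assms(2)] by blast+
qed

text \<open>All generating sequences of one decimal have the same limit, and the limit of a sum or product
  depends on the limits of its parts only. Hence one choice of generating sequences suffices.\<close>

lemma dec_add_eqI: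
  assumes "generates a d" "generates b e" "generates (\<lambda>n. a n + b n) f"
  shows "dec_add d e = f"
  unfolding dec_add_def
proof (rule the_equality)
  show "\<exists>a b. generates a d \<and> generates b e \<and> generates (\<lambda>n. a n + b n) f"
    using assms by (intro exI conjI)
next
  fix f'
  assume "\<exists>a b. generates a d \<and> generates b e \<and> generates (\<lambda>n. a n + b n) f'"
  then obtain a' b' where ab': "generates a' d" "generates b' e" "generates (\<lambda>n. a' n + b' n) f'"
    by blast
  obtain L where L: "(\<lambda>n. real_of_rat (a n)) \<longlonglongrightarrow> L" "(\<lambda>n. real_of_rat (a' n)) \<longlonglongrightarrow> L"
    by (rule generating_sequences_common_limit[OF assms(1) ab'(1)])
  obtain L' where L': "(\<lambda>n. real_of_rat (b n)) \<longlonglongrightarrow> L'" "(\<lambda>n. real_of_rat (b' n)) \<longlonglongrightarrow> L'"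
    by (rule generating_sequences_common_limit[OF assms(2) ab'(2)])
  show "f' = f"
    by (rule generated_decimal_unique[OF ab'(3) assms(3)])
      (unfold of_rat_add, rule tendsto_add[OF L(2) L'(2)], rule tendsto_add[OF L(1) L'(1)])
qed

lemma dec_mult_eqI:
  assumes "generates a d" "generates b e" "generates (\<lambda>n. a n * b n) f"
  shows "dec_mult d e = f"
  unfolding dec_mult_def
proof (rule the_equality)
  show "\<exists>a b. generates a d \<and> generates b e \<and> generates (\<lambda>n. a n * b n) f"
    using assms by (intro exI conjI)
next
  fix f'
  assume "\<exists>a b. generates a d \<and> generates b e \<and> generates (\<lambda>n. a n * b n) f'"
  then obtain a' b' where ab': "generates a' d" "generates b' e" "generates (\<lambda>n. a' n * b' n) f'"
    by blast
  obtain L where L: "(\<lambda>n. real_of_rat (a n)) \<longlonglongrightarrow> L" "(\<lambda>n. real_of_rat (a' n)) \<longlonglongrightarrow> L"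
    by (rule generating_sequences_common_limit[OF assms(1) ab'(1)])
  obtain L' where L': "(\<lambda>n. real_of_rat (b n)) \<longlonglongrightarrow> L'" "(\<lambda>n. real_of_rat (b' n)) \<longlonglongrightarrow> L'"
    by (rule generating_sequences_common_limit[OF assms(2) ab'(2)])
  show "f' = f"
    by (rule generated_decimal_unique[OF ab'(3) assms(3)])
      (unfold of_rat_mult, rule tendsto_mult[OF L(2) L'(2)], rule tendsto_mult[OF L(1) L'(1)])
qed

section \<open>The encoding is injective\<close>

lemma binary_inj: "binary m = binary n \<Longrightarrow> m = n"
proof (induction m arbitrary: n rule: binary.induct)
  case (1 m)
  have nonempty: "binary k \<noteq> []" for k
    by (subst binary.simps) simp
  show ?case
  proof (cases "m < 2 \<or> n < 2")
    case True
    then show ?thesis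
      using 1(2) nonempty nonempty[symmetric]
      by (subst (asm) (1 2) binary.simps) (auto split: if_splits)
  next
    case False
    then have "m mod 2 = n mod 2" "binary (m div 2) = binary (n div 2)"
      using 1(2) by (subst (asm) (1 2) binary.simps; simp)+
    moreover from this(2) have "m div 2 = n div 2"
      using 1(1) False by simp
    ultimately show ?thesis
      by (metis div_mult_mod_eq)
  qed
qed

text \<open>The word can be cut at the first occurrence of the separator.\<close>

lemma conc_separator_eqD:
  assumes "(xs @ [s]) \<frown> v = (ys @ [s]) \<frown> w" "s \<notin> set xs" "s \<notin> set ys"
  shows "xs = ys \<and> v = w"
  using assms
proof (induction xs arbitrary: ys)
  case Nil
  show ?case
  proof (cases ys)
    case Nil
    have "v i = w i" for i
      using fun_cong[OF Nil.prems(1), of "Suc i"] Nil by (simp add: conc_def)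
    then show ?thesis using Nil by auto
  next
    case (Cons y ys')
    then show ?thesis
      using fun_cong[OF Nil.prems(1), of 0] Nil.prems(3) by (simp add: conc_def)
  qed
next
  case (Cons x xs)
  show ?case
  proof (cases ys)
    case Nil
    then show ?thesis
      using fun_cong[OF Cons.prems(1), of 0] Cons.prems(2) by (simp add: conc_def)
  next
    case ys: (Cons y ys')
    have "((xs @ [s]) \<frown> v) i = ((ys' @ [s]) \<frown> w) i" for i
      using fun_cong[OF Cons.prems(1), of "Suc i"] ys
      by (simp add: conc_def nth_Cons split: if_splits)
    then have "xs = ys' \<and> v = w"
      using Cons.IH[of ys'] Cons.prems ys by auto
    moreover have "x = y"
      using fun_cong[OF Cons.prems(1), of 0] ys by (simp add: conc_def)
    ultimately show ?thesis using ys by simp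
  qed
qed

lemma inj_on_encode: "inj_on encode decimals"
proof (rule inj_onI)
  fix d e
  assume d: "d \<in> decimals" and e: "e \<in> decimals" and eq: "encode d = encode e"
  define pre where
    "pre d = (if is_neg d then [Minus] else []) @ map Digit (binary (ord_of d))" for d
  define tail where "tail d = (\<lambda>i. Digit (digit d (int (ord_of d) - int i)))" for d
  have encode: "encode d = (pre d @ [Sep]) \<frown> tail d" for d
    by (simp add: encode_def pre_def tail_def)
  have pre: "pre d = pre e" and tail: "tail d = tail e"
    using conc_separator_eqD[of "pre d" Sep "tail d" "pre e" "tail e"] eq
    by (auto simp: encode) (auto simp: pre_def split: if_splits)
  have neg: "is_neg d \<longleftrightarrow> Minus \<in> set (pre d)" for d
    by (auto simp: pre_def)
  have sign: "is_neg d = is_neg e"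
    using pre neg by metis
  then have "map Digit (binary (ord_of d)) = map Digit (binary (ord_of e))"
    using pre by (simp add: pre_def)
  then have ord: "ord_of d = ord_of e"
    by (intro binary_inj) (simp add: inj_def)
  have "digit d n = digit e n" for n
  proof (cases "n \<le> int (ord_of d)")
    case True
    then show ?thesis
      using fun_cong[OF tail, of "nat (int (ord_of d) - n)"] ord by (simp add: tail_def)
  next
    case False
    then show ?thesis
      using ord decimals_digit_above[OF d] decimals_digit_above[OF e] by simp
  qed
  then show "d = e"
    using sign ord by (intro decimal.expand) auto
qed

lemma transport_encode:
  assumes "d \<in> decimals" "e \<in> decimals"
  shows "transport f (encode d) (encode e) = encode (f d e)"
  using assms by (simp add: transport_def the_inv_into_f_f[OF inj_on_encode])

lemma encode_first_symbol:
  assumes "ord_of d = 0"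
  shows "encode d 0 = (if is_neg d then Minus else Digit 0)"
  using assms by (simp add: encode_def conc_def binary.simps)

section \<open>Discontinuity at results equal to zero\<close>

text \<open>The decimal \<open>\<plusminus> (a + b \<sqdot> 10\<^bsup>- (N + 1)\<^esup>)\<close>: for \<open>b = 1\<close> and growing \<open>N\<close> a sequence whose words
  converge symbol by symbol to the word of the decimal with \<open>b = 0\<close>.\<close>

definition two_digit :: "bool \<Rightarrow> nat \<Rightarrow> nat \<Rightarrow> nat \<Rightarrow> decimal" where
  "two_digit s a b N =
     Decimal s 0 (\<lambda>i. if i = 0 then a else if i = - int (Suc N) then b else 0)"

definition two_digit_value :: "bool \<Rightarrow> nat \<Rightarrow> nat \<Rightarrow> nat \<Rightarrow> rat" where
  "two_digit_value s a b N = (if s then - 1 else 1) * (of_nat a + of_nat b / 10 ^ Suc N)"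

lemma two_digit_in_decimals:
  assumes "a \<le> 9" "b \<le> 9" "s \<Longrightarrow> a \<noteq> 0 \<or> b \<noteq> 0"
  shows "two_digit s a b N \<in> decimals"
proof -
  have "\<not> (\<forall>m\<le>n. digit (two_digit s a b N) m = 9)" for n
  proof
    assume "\<forall>m\<le>n. digit (two_digit s a b N) m = 9"
    \<comment> \<open>All digits below the place \<open>- (N + 1)\<close> are 0.\<close>
    from this[rule_format, of "min n (- int (Suc (Suc N)))"] show False
      by (simp add: two_digit_def split: if_splits)
  qed
  moreover have "digit (two_digit s a b N) 0 = a" "digit (two_digit s a b N) (- int (Suc N)) = b"
    by (simp_all add: two_digit_def)
  then have "\<not> (s \<and> (\<forall>n\<le>0. digit (two_digit s a b N) n = 0))"
    using assms(3) by (metis neg_le_0_iff_le of_nat_0_le_iff order_refl)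
  ultimately show ?thesis
    using assms(1,2) by (auto simp: decimals_def two_digit_def)
qed

lemma trunc_two_digit:
  assumes "Suc N \<le> m"
  shows "trunc (two_digit s a b N) m = two_digit_value s a b N"
proof -
  let ?f = "\<lambda>n. of_nat (digit (two_digit s a b N) n) * (10::rat) powi n"
  have "(\<Sum>n = - int m..0. ?f n) = sum ?f {0, - int (Suc N)}"
    using assms by (intro sum.mono_neutral_right) (auto simp: two_digit_def)
  also have "\<dots> = of_nat a + of_nat b * 10 powi (- int (Suc N))"
    by (simp add: two_digit_def)
  also have "\<dots> = of_nat a + of_nat b / 10 ^ Suc N"
    by (simp only: power_int_minus power_int_of_nat divide_inverse)
  finally show ?thesis
    by (simp add: trunc_def two_digit_value_def two_digit_def)
qed

lemma two_digit_value_in_Q_D: "two_digit_value s a b N \<in> Q_D"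
proof -
  have "two_digit_value s a b N =
      of_int ((if s then - 1 else 1) * (int a * 10 ^ Suc N + int b)) / 10 ^ Suc N"
    by (simp add: two_digit_value_def field_simps)
  then show ?thesis
    unfolding Q_D_def by blast
qed

lemma generates_two_digit:
  assumes "a \<le> 9" "b \<le> 9" "s \<Longrightarrow> a \<noteq> 0 \<or> b \<noteq> 0"
  shows "generates (\<lambda>_. two_digit_value s a b N) (two_digit s a b N)"
  unfolding generates_def cauchy_QD_def
  using two_digit_in_decimals[OF assms] two_digit_value_in_Q_D
  by (auto simp: trunc_two_digit intro!: exI[of _ "Suc N"])

lemma two_digit_eq: "two_digit s a 0 N = two_digit s a 0 N'"
  by (auto simp: two_digit_def)

text \<open>The place \<open>- (N + 1)\<close> is encoded to the right of the position \<open>N\<close>.\<close>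

lemma encode_two_digit_prefix:
  assumes "i < N"
  shows "encode (two_digit s a b N) i = encode (two_digit s a 0 0) i"
  using assms by (auto simp: encode_def two_digit_def conc_def)

lemma dec_add_two_digit:
  assumes "b \<le> 9"
  shows "dec_add (two_digit True 1 b N) (two_digit False 1 0 N) = two_digit (b \<noteq> 0) 0 b N"
proof (rule dec_add_eqI)
  show "generates (\<lambda>_. two_digit_value True 1 b N) (two_digit True 1 b N)"
    and "generates (\<lambda>_. two_digit_value False 1 0 N) (two_digit False 1 0 N)"
    using assms by (auto intro: generates_two_digit)
  have "two_digit_value True 1 b N + two_digit_value False 1 0 N =
      two_digit_value (b \<noteq> 0) 0 b N"
    by (auto simp: two_digit_value_def)
  then show "generates (\<lambda>_. two_digit_value True 1 b N + two_digit_value False 1 0 N)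
      (two_digit (b \<noteq> 0) 0 b N)"
    using assms generates_two_digit[of 0 b "b \<noteq> 0" N] by simp
qed

lemma dec_mult_two_digit:
  assumes "b \<le> 9"
  shows "dec_mult (two_digit False 0 b N) (two_digit True 1 0 N) = two_digit (b \<noteq> 0) 0 b N"
proof (rule dec_mult_eqI)
  show "generates (\<lambda>_. two_digit_value False 0 b N) (two_digit False 0 b N)"
    and "generates (\<lambda>_. two_digit_value True 1 0 N) (two_digit True 1 0 N)"
    using assms by (auto intro: generates_two_digit)
  have "two_digit_value False 0 b N * two_digit_value True 1 0 N =
      two_digit_value (b \<noteq> 0) 0 b N"
    by (auto simp: two_digit_value_def)
  then show "generates (\<lambda>_. two_digit_value False 0 b N * two_digit_value True 1 0 N)
      (two_digit (b \<noteq> 0) 0 b N)"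
    using assms generates_two_digit[of 0 b "b \<noteq> 0" N] by simp
qed

text \<open>The common argument for both operations: as \<open>b\<close> changes from 0 to 1, the result jumps from 0
  to a negative decimal, while the first argument changes beyond its first \<open>N\<close> symbols only.\<close>

lemma not_computable_if_sign_jump:
  assumes jump: "\<And>b N. b \<le> 1 \<Longrightarrow>
      f (two_digit s a b N) (two_digit s' a' 0 N) = two_digit (b \<noteq> 0) 0 b N"
    and le: "a \<le> 9" "a' \<le> 9" and nonzero: "s \<Longrightarrow> a \<noteq> 0" "s' \<Longrightarrow> a' \<noteq> 0"
  shows "\<not> computable A X_R (transport f)"
proof
  assume comp: "computable A X_R (transport f)"
  have dec: "two_digit s a b N \<in> decimals" "two_digit s' a' 0 N \<in> decimals" if "b \<le> 1" for b N
    using that le nonzero by (auto intro!: two_digit_in_decimals)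
  have X: "encode (two_digit s a b N) \<in> X_R" "encode (two_digit s' a' 0 N) \<in> X_R" if "b \<le> 1" for b N
    using dec[OF that] by (auto simp: X_R_def)
  have first: "transport f (encode (two_digit s a b N)) (encode (two_digit s' a' 0 0)) 0 =
      (if b \<noteq> 0 then Minus else Digit 0)" if "b \<le> 1" for b N
  proof -
    have "transport f (encode (two_digit s a b N)) (encode (two_digit s' a' 0 N)) =
        encode (two_digit (b \<noteq> 0) 0 b N)"
      using dec jump that by (simp add: transport_encode)
    then show ?thesis
      using encode_first_symbol[of "two_digit (b \<noteq> 0) 0 b N"] two_digit_eq[of s' a' N 0]
      by (simp add: two_digit_def)
  qed
  obtain N where N: "\<And>x' y'. x' \<in> X_R \<Longrightarrow> y' \<in> X_R \<Longrightarrow>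
      (\<And>i. i < N \<Longrightarrow> x' i = encode (two_digit s a 0 0) i) \<Longrightarrow>
      (\<And>i. i < N \<Longrightarrow> y' i = encode (two_digit s' a' 0 0) i) \<Longrightarrow>
      transport f x' y' 0 =
        transport f (encode (two_digit s a 0 0)) (encode (two_digit s' a' 0 0)) 0"
    using computable_imp_locally_constant[OF comp X(1) X(2), of 0 0 0 0 0] by auto
  have "transport f (encode (two_digit s a 1 N)) (encode (two_digit s' a' 0 0)) 0 =
      transport f (encode (two_digit s a 0 0)) (encode (two_digit s' a' 0 0)) 0"
    using X encode_two_digit_prefix by (intro N) auto
  then show False
    using first[of 1 N] first[of 0 0] by simp
qed

theorem theorem4p3: "\<not> computable A_R X_R add_R \<and> \<not> computable A_R X_R mult_R"
proof
  show "\<not> computable A_R X_R add_R"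
    unfolding add_R_def
    by (rule not_computable_if_sign_jump[OF dec_add_two_digit]) simp_all
  show "\<not> computable A_R X_R mult_R"
    unfolding mult_R_def
    by (rule not_computable_if_sign_jump[OF dec_mult_two_digit]) simp_all
qed

end
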